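(* Consider a dataset $\{(x_i,y_i)\}_{i=1}^n$ with $x_i\in\mathbb{R}^d$, $y_i\in\mathbb{R}$, $\|x_i\|_2=1$ for all $i$, and $x_i\neq x_j$ for $i\neq j$; an activation function $\gamma$ whose matrix $H$ (defined in the context) satisfies $\lambda_{\min}(H)>0$; and a failure probability $0<\delta<1$. Let $m$ be an integer with $$m\geq \frac{10\,n\,C^2\log(2n/\delta)}{\lambda_{\min}(H)},$$ and let $W\in\mathbb{R}^{d\times m}$ be a weight matrix with columns drawn i.i.d. from the uniform distribution on $\mathbb{S}^{d-1}$. Then, with probability at least $1-\delta$, there is a unique least-norm solution to $$\min_{\alpha\in\mathbb{R}^m}\left\|\frac{1}{\sqrt{m}}\gamma(X^TW)\alpha-y\right\|_2^2$$ that achieves zero objective value. Furthermore, when there is such a unique least-norm solution, the sequence of iterates $\{\alpha^{(k)}\}_{k=0}^\infty$ generated by gradient descent on $$f(\alpha)=\frac12\left\|\frac{1}{\sqrt{m}}\gamma(X^TW)\alpha-y\right\|_2^2$$ with $\alpha^{(0)}=0$ and fixed step size $\eta$ satisfying $0<\eta<2/\lambda_{\max}(\widehat{H})$ converges to this least-norm solution as $k\to\infty$.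
   Context: $X\in\mathbb{R}^{d\times n}$ has columns $x_1,\ldots,x_n$ and $y=(y_1,\ldots,y_n)^T$. The activation function $\gamma:\mathbb{R}\to\mathbb{R}$ is Lipschitz continuous, satisfies $|\gamma(z)|\le C$ for $z\in[-1,1]$, and is applied to vectors and matrices entrywise. $\mathbb{S}^{d-1}$ is the unit sphere in $\mathbb{R}^d$. The $n\times n$ matrices $H$ and $\widehat{H}$ are $$H_{ij}=\mathbb{E}_{w}\big[\gamma(x_i^Tw)\gamma(w^Tx_j)\big]\ \ (w \text{ uniform on } \mathbb{S}^{d-1}),\qquad \widehat{H}_{ij}=\frac1m\sum_{k=1}^m\gamma(x_i^Tw_k)\gamma(w_k^Tx_j),$$ where $w_1,\dots,w_m$ are the columns of $W$. $\lambda_{\min},\lambda_{\max}$ denote smallest and largest eigenvalues. The least-norm solution is the minimizer with smallest Euclidean norm. Gradient descent is $\alpha^{(k+1)}=\alpha^{(k)}-\eta\nabla f(\alpha^{(k)})$. *)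

theory Defs
  imports "HOL-Probability.Probability"
begin

text \<open>
  The uniform distribution on the unit sphere is the law of the direction of a uniformly
  distributed point of the unit ball, i.e. the normalised cone measure
  \<open>A \<mapsto> vol {t x | x \<in> A, 0 < t < 1} / vol (ball 0 1)\<close>. Here \<open>sgn x = x /\<^sub>R norm x\<close>; the
  exceptional point \<open>sgn 0 = 0\<close> has measure zero. The lemmas below show that it is a
  probability measure, is carried by the sphere and is rotation invariant. A sample is a
  point of the ambient space, so the measure lives on \<open>borel\<close>.
\<close>

definition uniform_sphere :: "'a::euclidean_space measure" where
  "uniform_sphere = distr (uniform_measure lborel (ball 0 1)) borel sgn"

lemma measurable_sgn_euclidean [measurable]:
  "(sgn :: 'a::euclidean_space \<Rightarrow> 'a) \<in> borel_measurable borel"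
  unfolding sgn_div_norm[abs_def] by measurable

lemma emeasure_unit_ball:
  "emeasure lborel (ball (0::'a::euclidean_space) 1) \<noteq> 0"
  "emeasure lborel (ball (0::'a::euclidean_space) 1) \<noteq> \<infinity>"
proof -
  show "emeasure lborel (ball (0::'a) 1) \<noteq> \<infinity>"
    using emeasure_lborel_ball_finite[of "0::'a" 1] by simp
  have "measure lebesgue (ball (0::'a) 1) > 0"
    by (simp add: content_ball_pos)
  then show "emeasure lborel (ball (0::'a) 1) \<noteq> 0"
    by (auto simp: measure_def)
qed

lemma prob_space_uniform_sphere: "prob_space uniform_sphere"
  unfolding uniform_sphere_def
  by (intro prob_space.prob_space_distr prob_space_uniform_measure emeasure_unit_ball) simp

lemma AE_uniform_sphere: "AE w in uniform_sphere. norm w = 1"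
proof -
  have "AE x in lborel. x \<noteq> (0::'a)"
    by (rule AE_lborel_singleton)
  then have "AE x in uniform_measure lborel (ball (0::'a) 1). norm (sgn x) = 1"
    by (intro AE_uniform_measureI) (auto simp: norm_sgn)
  then show ?thesis
    unfolding uniform_sphere_def by (subst AE_distr_iff) simp_all
qed

lemma uniform_sphere_orthogonal_invariant:
  fixes f :: "real^'d::{finite,wellorder} \<Rightarrow> real^'d::_"
  assumes f: "orthogonal_transformation f"
  shows "distr uniform_sphere borel f = uniform_sphere"
proof -
  have lin: "linear f"
    using f by (rule orthogonal_transformation_linear)
  have fm [measurable]: "f \<in> borel_measurable borel"
    using lin by (intro borel_measurable_continuous_onI linear_continuous_on)
      (simp add: linear_conv_bounded_linear)
  have nf: "norm (f x) = norm x" for x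
    using f by (rule orthogonal_transformation_norm)
  have sf: "f (sgn x) = sgn (f x)" for x
    by (simp add: sgn_div_norm nf linear_cmul[OF lin])
  obtain g where g: "orthogonal_transformation g" "\<And>x. g (f x) = x" "\<And>x. f (g x) = x"
    using f orthogonal_transformation_inv[OF f] orthogonal_transformation_bij[OF f]
    by (metis bij_inv_eq_iff)
  have eq: "f -` A = g ` A" for A
  proof
    show "f -` A \<subseteq> g ` A"
      using g(2) by (metis image_eqI subsetI vimage_eq)
    show "g ` A \<subseteq> f -` A"
      using g(3) by auto
  qed
  have "lborel = distr lborel borel f"
  proof (rule lborel_eqI)
    fix l u :: "real^'d::_"
    assume lu: "\<And>b. b \<in> Basis \<Longrightarrow> l \<bullet> b \<le> u \<bullet> b"
    have box: "box l u \<in> lmeasurable"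
      by simp
    have im: "g ` box l u \<in> lmeasurable"
      using g(1) box by (rule measurable_orthogonal_image)
    have bor: "f -` box l u \<in> sets borel"
      using measurable_sets[OF fm, of "box l u"] by simp
    have "emeasure (distr lborel borel f) (box l u) = emeasure lborel (f -` box l u)"
      by (simp add: emeasure_distr)
    also have "\<dots> = emeasure lebesgue (f -` box l u)"
      using bor by simp
    also have "\<dots> = emeasure lebesgue (g ` box l u)"
      by (simp add: eq)
    also have "\<dots> = ennreal (measure lebesgue (g ` box l u))"
      using im by (simp add: emeasure_eq_measure2)
    also have "\<dots> = ennreal (measure lebesgue (box l u))"
      using measure_orthogonal_image[OF g(1) box] by simp
    also have "\<dots> = emeasure lebesgue (box l u)"
      using box by (simp add: emeasure_eq_measure2)
    also have "\<dots> = (\<Prod>b\<in>Basis. (u - l) \<bullet> b)"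
      using lu by (simp add: emeasure_lborel_box_eq inner_diff_left)
    finally show "emeasure (distr lborel borel f) (box l u) = (\<Prod>b\<in>Basis. (u - l) \<bullet> b)" .
  qed simp
  then have inv: "emeasure lborel (f -` A) = emeasure lborel A" if "A \<in> sets borel" for A
    using that emeasure_distr[of f lborel borel A] by simp
  have "distr uniform_sphere borel f
      = distr (distr (uniform_measure lborel (ball 0 1)) borel f) borel sgn"
    unfolding uniform_sphere_def by (simp add: distr_distr comp_def sf)
  also have "distr (uniform_measure lborel (ball 0 1)) borel f
      = uniform_measure lborel (ball 0 1)"
  proof (rule measure_eqI)
    fix A :: "(real^'d::_) set"
    assume "A \<in> sets (distr (uniform_measure lborel (ball 0 1)) borel f)"
    then have A [measurable]: "A \<in> sets borel" by simp
    have m: "f -` A \<in> sets borel"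
      using measurable_sets[OF fm A] by simp
    have "ball 0 1 \<inter> f -` A = f -` (ball 0 1 \<inter> A)"
      by (auto simp: nf)
    then have "emeasure lborel (ball 0 1 \<inter> f -` A) = emeasure lborel (ball 0 1 \<inter> A)"
      using inv[of "ball 0 1 \<inter> A"] by simp
    with m show "emeasure (distr (uniform_measure lborel (ball 0 1)) borel f) A
        = emeasure (uniform_measure lborel (ball 0 1)) A"
      by (simp add: emeasure_distr emeasure_uniform_measure)
  qed simp
  finally show ?thesis
    unfolding uniform_sphere_def .
qed

definition eigenvalues :: "real^'n^'n \<Rightarrow> real set" where
  "eigenvalues A = {l. \<exists>v. v \<noteq> 0 \<and> A *v v = l *\<^sub>R v}"

definition lambda_min :: "real^'n^'n \<Rightarrow> real" where
  "lambda_min A = Min (eigenvalues A)"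

definition lambda_max :: "real^'n^'n \<Rightarrow> real" where
  "lambda_max A = Max (eigenvalues A)"

text \<open>The matrices used below are symmetric, so that \<open>Min\<close> and \<open>Max\<close> are meaningful.\<close>

lemma finite_eigenvalues:
  fixes A :: "real^'n^'n"
  assumes "transpose A = A"
  shows "finite (eigenvalues A)"
proof -
  have "\<forall>l\<in>eigenvalues A. \<exists>v. v \<noteq> 0 \<and> A *v v = l *\<^sub>R v"
    by (auto simp: eigenvalues_def)
  then obtain v where v: "\<And>l. l \<in> eigenvalues A \<Longrightarrow> v l \<noteq> 0"
    "\<And>l. l \<in> eigenvalues A \<Longrightarrow> A *v v l = l *\<^sub>R v l"
    by metis
  have orth: "v l \<bullet> v k = 0" if "l \<in> eigenvalues A" "k \<in> eigenvalues A" "l \<noteq> k" for l k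
  proof -
    have "(A *v v l) \<bullet> v k = v l \<bullet> (A *v v k)"
      using assms by (metis dot_lmul_matrix transpose_matrix_vector)
    then show ?thesis
      using that by (simp add: v)
  qed
  have "inj_on v (eigenvalues A)"
    using orth v(1) by (metis inj_onI inner_eq_zero_iff)
  moreover have "pairwise orthogonal (v ` eigenvalues A)"
    using orth by (auto simp: pairwise_def orthogonal_def)
  then have "finite (v ` eigenvalues A)"
    by (rule pairwise_orthogonal_imp_finite)
  ultimately show ?thesis
    by (simp add: finite_image_iff)
qed

lemma eigenvalues_nonempty:
  fixes A :: "real^'n^'n"
  assumes "transpose A = A"
  shows "eigenvalues A \<noteq> {}"
proof -
  have sym: "(A *v x) \<bullet> y = x \<bullet> (A *v y)" for x y
    using assms by (metis dot_lmul_matrix transpose_matrix_vector)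
  have "compact (sphere (0::real^'n) 1)" "sphere (0::real^'n) 1 \<noteq> {}"
    by simp_all
  moreover have "continuous_on (sphere 0 1) (\<lambda>x. x \<bullet> (A *v x))"
    by (intro continuous_intros matrix_vector_mult_linear_continuous_on)
  ultimately have "\<exists>v\<in>sphere 0 1. \<forall>x\<in>sphere 0 1. x \<bullet> (A *v x) \<le> v \<bullet> (A *v v)"
    by (rule continuous_attains_sup)
  then obtain v where v: "norm v = 1" "\<And>x. norm x = 1 \<Longrightarrow> x \<bullet> (A *v x) \<le> v \<bullet> (A *v v)"
    by auto
  define l where "l = v \<bullet> (A *v v)"
  define B where "B = (\<lambda>x. l *\<^sub>R x - A *v x)"
  have B0: "x \<bullet> B x \<ge> 0" for x
  proof (cases "x = 0")
    case False
    have "sgn x \<bullet> (A *v sgn x) \<le> l"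
      using v(2)[of "sgn x"] False by (simp add: norm_sgn l_def)
    then have "(norm x)\<^sup>2 * (sgn x \<bullet> (A *v sgn x)) \<le> (norm x)\<^sup>2 * l"
      by (simp add: mult_left_mono)
    also have "(norm x)\<^sup>2 * (sgn x \<bullet> (A *v sgn x))
        = (norm x *\<^sub>R sgn x) \<bullet> (A *v (norm x *\<^sub>R sgn x))"
      by (simp add: matrix_vector_mult_scaleR power2_eq_square)
    also have "norm x *\<^sub>R sgn x = x"
      using False by (simp add: sgn_div_norm)
    finally show ?thesis
      by (simp add: B_def inner_diff_right power2_norm_eq_inner mult.commute)
  qed simp
  have vB: "v \<bullet> B v = 0"
    using v(1) by (simp add: B_def l_def inner_diff_right flip: power2_norm_eq_inner)
  have Badd: "B (x - t *\<^sub>R y) = B x - t *\<^sub>R B y" for x y t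
    by (simp add: B_def algebra_simps matrix_vector_mult_diff_distrib matrix_vector_mult_scaleR)
  have Bsym: "x \<bullet> B y = B x \<bullet> y" for x y
    by (simp add: B_def inner_diff_left inner_diff_right sym)
  define w c where "w = B v" and "c = w \<bullet> B w"
  have quad: "2 * t * (w \<bullet> w) \<le> t\<^sup>2 * c" for t
  proof -
    have "0 \<le> (v - t *\<^sub>R w) \<bullet> B (v - t *\<^sub>R w)"
      by (rule B0)
    also have "\<dots> = t\<^sup>2 * c - 2 * t * (w \<bullet> w)"
      unfolding Badd using vB Bsym[of v w]
      by (simp add: inner_diff_left inner_diff_right w_def c_def power2_eq_square algebra_simps)
    finally show ?thesis by simp
  qed
  have c: "c \<ge> 0"
    using B0 by (simp add: c_def)
  define r where "r = (w \<bullet> w) / (c + 1)"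
  have r: "w \<bullet> w = r * (c + 1)"
    using c by (simp add: r_def)
  have "r\<^sup>2 * (c + 2) \<le> 0"
    using quad[of r] unfolding r by (simp add: algebra_simps power2_eq_square)
  then have "r = 0"
    using c by (simp add: mult_le_0_iff)
  then have "w = 0"
    using r by simp
  then have "A *v v = l *\<^sub>R v"
    by (simp add: w_def B_def)
  moreover have "v \<noteq> 0"
    using v(1) by auto
  ultimately have "l \<in> eigenvalues A"
    unfolding eigenvalues_def by blast
  then show ?thesis
    by blast
qed

text \<open>
  The columns of \<open>X\<close> are the data points and the columns of \<open>W\<close> are the weight vectors;
  \<open>expected_gram\<close> is the matrix \<open>H\<close> and \<open>empirical_gram\<close> its empirical average.
\<close>

definition expected_gram :: "(real \<Rightarrow> real) \<Rightarrow> real^'n^'d \<Rightarrow> real^'n^'n" where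
  "expected_gram \<gamma> X =
     (\<chi> i j. \<integral>w. \<gamma> (column i X \<bullet> w) * \<gamma> (w \<bullet> column j X) \<partial>uniform_sphere)"

definition empirical_gram :: "(real \<Rightarrow> real) \<Rightarrow> real^'n^'d \<Rightarrow> real^'m^'d \<Rightarrow> real^'n^'n" where
  "empirical_gram \<gamma> X W =
     (\<chi> i j. (1 / real CARD('m)) *
        (\<Sum>k\<in>UNIV. \<gamma> (column i X \<bullet> column k W) * \<gamma> (column k W \<bullet> column j X)))"

definition residual ::
    "(real \<Rightarrow> real) \<Rightarrow> real^'n^'d \<Rightarrow> real^'n \<Rightarrow> real^'m^'d \<Rightarrow> real^'m \<Rightarrow> real^'n" where
  "residual \<gamma> X y W \<alpha> =
     ((1 / sqrt (real CARD('m))) *\<^sub>R map_matrix \<gamma> (transpose X ** W)) *v \<alpha> - y"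

definition least_norm_minimizer :: "('a::real_normed_vector \<Rightarrow> real) \<Rightarrow> 'a \<Rightarrow> bool" where
  "least_norm_minimizer F a \<longleftrightarrow> is_arg_min norm (is_arg_min F (\<lambda>_. True)) a"

definition gradient :: "('a::real_inner \<Rightarrow> real) \<Rightarrow> 'a \<Rightarrow> 'a" where
  "gradient f x = (THE D. GDERIV f x :> D)"

lemma gradient_eqI:
  assumes "GDERIV f x :> D"
  shows "gradient f x = D"
  unfolding gradient_def
proof (rule the_equality)
  fix E assume "GDERIV f x :> E"
  with assms have "(\<lambda>h. h \<bullet> E) = (\<lambda>h. h \<bullet> D)"
    unfolding gderiv_def by (rule has_derivative_unique[rotated])
  then show "E = D"
    by (metis vector_eq_ldot)
qed (fact assms)

primrec gradient_descent :: "('a::real_inner \<Rightarrow> real) \<Rightarrow> real \<Rightarrow> 'a \<Rightarrow> nat \<Rightarrow> 'a" where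
  "gradient_descent f \<eta> a 0 = a"
| "gradient_descent f \<eta> a (Suc k) =
     gradient_descent f \<eta> a k - \<eta> *\<^sub>R gradient f (gradient_descent f \<eta> a k)"

end

theory Submission
  imports Defs
begin

text \<open>
  Write \<open>F\<close> for the \<open>n \<times> m\<close> matrix \<open>\<gamma>(X\<^sup>T W) / sqrt m\<close>. A unique least-norm solution with zero
  objective exists exactly when \<open>F a = y\<close> is solvable: the unique solution in the row space of
  \<open>F\<close> is orthogonal to its difference from any other solution, so Pythagoras makes it the
  shortest one.

  \<^bold>\<open>The probability.\<close> If \<open>F a = y\<close> is unsolvable, the feature vectors
  \<open>v\<^sub>k = \<gamma>(X\<^sup>T w\<^sub>k)\<close> do not span \<open>\<real>\<^sup>n\<close>. These are independent, they satisfy almost surely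
  \<open>\<parallel>v\<^sub>k\<parallel>\<^sup>2 \<le> R = n C\<^sup>2\<close>, and \<open>E (x \<bullet> v\<^sub>k)\<^sup>2 = x \<bullet> H x \<ge> \<kappa> \<parallel>x\<parallel>\<^sup>2\<close> with
  \<open>\<kappa> = \<lambda>\<^sub>m\<^sub>i\<^sub>n(H)\<close>. Instead of a matrix Chernoff bound, a coupon-collector argument suffices.
  Let \<open>Q\<close> be the orthogonal projection onto the complement of the span of the vectors seen so
  far. A further independent vector \<open>v\<close> lowers the trace of \<open>Q\<close> (the missing dimension) by \<open>1\<close>
  if \<open>Q v \<noteq> 0\<close> and leaves it alone otherwise, hence lowers it by at least
  \<open>\<parallel>Q v\<parallel>\<^sup>2 / R\<close>. Given \<open>Q\<close>, the expectation of this is \<open>tr (Q H) / R \<ge> \<kappa> tr Q / R\<close>, so each vector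
  multiplies the expected missing dimension by at most \<open>1 - \<kappa> / R\<close>
  (\<open>trace_complement_projection_expectation_step\<close>). After \<open>m\<close> vectors it is at most
  \<open>n (1 - \<kappa> / R)\<^sup>m \<le> n exp (- \<kappa> m / R)\<close>. Whenever the vectors do not span, the missing dimension is
  at least \<open>1\<close>, so by Markov's inequality this also bounds the probability that they do not span
  (\<open>prob_not_spanning_le\<close>). The hypothesis on \<open>m\<close> makes it smaller than \<open>\<delta>\<close>.

  \<^bold>\<open>The convergence.\<close> Started at \<open>0\<close>, gradient descent stays in the row space of \<open>F\<close>. With
  \<open>a\<close> the row-space solution, the error \<open>e = \<alpha> - a\<close> evolves by
  \<open>e \<mapsto> e - \<eta> F\<^sup>T F e\<close>. Since \<open>F F\<^sup>T\<close> is the empirical Gram matrix, with largest eigenvalue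
  \<open>\<Lambda>\<close>, one has \<open>\<parallel>F\<^sup>T u\<parallel>\<^sup>2 \<le> \<Lambda> \<parallel>u\<parallel>\<^sup>2\<close>, and a step lowers \<open>\<parallel>e\<parallel>\<^sup>2\<close> by at least
  \<open>\<eta> (2 - \<eta> \<Lambda>) \<parallel>F e\<parallel>\<^sup>2\<close>. On the row space \<open>F\<close> is injective, hence bounded below, and the error
  decays geometrically (\<open>gradient_descent_tendsto_row_space_solution\<close>).
\<close>

section \<open>Extreme eigenvalues and quadratic forms\<close>

lemma inner_matrix_vector_transpose:
  fixes A :: "real^'m^'n"
  shows "x \<bullet> (A *v y) = (transpose A *v x) \<bullet> y"
  by (metis dot_lmul_matrix transpose_matrix_vector)

text \<open>
  At a zero \<open>v\<close> of a nonnegative quadratic form the form is minimal, so its derivative \<open>2 B v\<close>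
  vanishes. Concretely, moving from \<open>v\<close> by a small multiple of \<open>- B v\<close> would make the form negative.
\<close>

lemma psd_form_zero_imp_kernel:
  fixes B :: "real^'n^'n"
  assumes sym: "transpose B = B" and psd: "\<And>x. 0 \<le> x \<bullet> (B *v x)" and zero: "v \<bullet> (B *v v) = 0"
  shows "B *v v = 0"
proof -
  define w c where "w = B *v v" and "c = w \<bullet> (B *v w)"
  have c: "0 \<le> c"
    using psd by (simp add: c_def)
  have quad: "0 \<le> t\<^sup>2 * c - 2 * t * (w \<bullet> w)" for t
  proof -
    have "v \<bullet> (B *v w) = w \<bullet> w"
      using inner_matrix_vector_transpose[of v B w] by (simp add: sym w_def)
    then have "(v - t *\<^sub>R w) \<bullet> (B *v (v - t *\<^sub>R w)) = t\<^sup>2 * c - 2 * t * (w \<bullet> w)"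
      using zero
      by (simp add: matrix_vector_mult_diff_distrib matrix_vector_mult_scaleR inner_diff_left
          inner_diff_right c_def power2_eq_square right_diff_distrib flip: w_def)
    then show ?thesis
      using psd[of "v - t *\<^sub>R w"] by simp
  qed
  \<comment> \<open>The minimizer of the quadratic is \<open>t = (w \<bullet> w) / c\<close>; the shifted denominator avoids \<open>c = 0\<close>
    and still makes the quadratic negative unless \<open>w = 0\<close>.\<close>
  define r where "r = (w \<bullet> w) / (c + 1)"
  have "w \<bullet> w = r * (c + 1)"
    using c by (simp add: r_def)
  moreover from this have "r\<^sup>2 * (c + 2) \<le> 0"
    using quad[of r] by (simp add: algebra_simps power2_eq_square)
  then have "r = 0"
    using c by (simp add: mult_le_0_iff)
  ultimately have "w \<bullet> w = 0"
    by simp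
  then show ?thesis
    by (simp add: w_def)
qed

text \<open>
  The Rayleigh quotient attains a maximum \<open>l\<close> on the compact unit sphere, at \<open>v\<close> say. Then
  \<open>l I - A\<close> is positive semidefinite and its form vanishes at \<open>v\<close>, so \<open>A v = l v\<close>.
\<close>

lemma rayleigh_max_eigenvalue:
  fixes A :: "real^'n^'n"
  assumes sym: "transpose A = A"
  obtains l where "l \<in> eigenvalues A" "\<And>x. x \<bullet> (A *v x) \<le> l * (norm x)\<^sup>2"
proof -
  have "compact (sphere (0::real^'n) 1)" "sphere (0::real^'n) 1 \<noteq> {}"
    by simp_all
  moreover have "continuous_on (sphere 0 1) (\<lambda>x. x \<bullet> (A *v x))"
    by (intro continuous_intros matrix_vector_mult_linear_continuous_on)
  ultimately have "\<exists>v\<in>sphere 0 1. \<forall>x\<in>sphere 0 1. x \<bullet> (A *v x) \<le> v \<bullet> (A *v v)"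
    by (rule continuous_attains_sup)
  then obtain v where v: "norm v = 1" "\<And>x. norm x = 1 \<Longrightarrow> x \<bullet> (A *v x) \<le> v \<bullet> (A *v v)"
    by auto
  define l where "l = v \<bullet> (A *v v)"
  have bound: "x \<bullet> (A *v x) \<le> l * (norm x)\<^sup>2" for x
  proof (cases "x = 0")
    case False
    have "sgn x \<bullet> (A *v sgn x) \<le> l"
      using v(2)[of "sgn x"] False by (simp add: norm_sgn l_def)
    then have "(norm x)\<^sup>2 * (sgn x \<bullet> (A *v sgn x)) \<le> (norm x)\<^sup>2 * l"
      by (simp add: mult_left_mono)
    moreover have "(norm x)\<^sup>2 * (sgn x \<bullet> (A *v sgn x)) = x \<bullet> (A *v x)"
      using False by (simp add: sgn_div_norm matrix_vector_mult_scaleR power2_eq_square field_simps)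
    ultimately show ?thesis
      by (simp add: mult.commute)
  qed simp
  define B where "B = l *\<^sub>R mat 1 - A"
  have B: "B *v x = l *\<^sub>R x - A *v x" for x
    by (simp add: B_def matrix_vector_mult_diff_rdistrib flip: scaleR_matrix_vector_assoc)
  have "B *v v = 0"
  proof (rule psd_form_zero_imp_kernel)
    show "transpose B = B"
      using sym by (auto simp: B_def transpose_def mat_def vec_eq_iff)
    show "0 \<le> x \<bullet> (B *v x)" for x
      using bound[of x] by (simp add: B inner_diff_right power2_norm_eq_inner)
    show "v \<bullet> (B *v v) = 0"
      using v(1) by (simp add: B inner_diff_right l_def flip: power2_norm_eq_inner)
  qed
  moreover have "v \<noteq> 0"
    using v(1) by auto
  ultimately have "l \<in> eigenvalues A"
    unfolding eigenvalues_def by (auto simp: B)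
  with bound show ?thesis
    using that by blast
qed

lemma quadratic_form_le_lambda_max:
  fixes A :: "real^'n^'n"
  assumes "transpose A = A"
  shows "x \<bullet> (A *v x) \<le> lambda_max A * (norm x)\<^sup>2"
proof -
  obtain l where l: "l \<in> eigenvalues A" "x \<bullet> (A *v x) \<le> l * (norm x)\<^sup>2"
    using rayleigh_max_eigenvalue[OF assms] by metis
  have "l \<le> lambda_max A"
    unfolding lambda_max_def using finite_eigenvalues[OF assms] l(1) by (rule Max_ge)
  then show ?thesis
    using l(2) by (smt (verit) mult_right_mono zero_le_power2)
qed

lemma lambda_min_le_quadratic_form:
  fixes A :: "real^'n^'n"
  assumes sym: "transpose A = A"
  shows "lambda_min A * (norm x)\<^sup>2 \<le> x \<bullet> (A *v x)"
proof -
  have neg: "(- A) *v v = - (A *v v)" for v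
    by (simp add: matrix_vector_mult_def vec_eq_iff sum_negf)
  have "transpose (- A) = - A"
    using sym by (auto simp: transpose_def vec_eq_iff)
  then obtain l where l: "l \<in> eigenvalues (- A)" "x \<bullet> ((- A) *v x) \<le> l * (norm x)\<^sup>2"
    using rayleigh_max_eigenvalue by metis
  have "- l \<in> eigenvalues A"
    using l(1) unfolding eigenvalues_def by (auto simp: neg) (metis minus_minus)
  then have "lambda_min A \<le> - l"
    unfolding lambda_min_def using finite_eigenvalues[OF sym] by (intro Min_le)
  then have "lambda_min A * (norm x)\<^sup>2 \<le> - l * (norm x)\<^sup>2"
    by (rule mult_right_mono) simp
  then show ?thesis
    using l(2) by (simp add: neg)
qed

section \<open>Least-norm solutions of linear systems\<close>

text \<open>
  The component of a solution orthogonal to the row space lies in the kernel of \<open>A\<close> and can be dropped.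
\<close>

lemma solvable_imp_row_space_solution:
  fixes A :: "real^'m^'n"
  assumes "A *v b = y"
  obtains a where "a \<in> range ((*v) (transpose A))" "A *v a = y"
proof -
  let ?S = "range ((*v) (transpose A))"
  have "subspace ?S"
    by (intro linear_subspace_image) auto
  then have span: "span ?S = ?S"
    by (simp add: span_eq_iff)
  obtain p q where p: "p \<in> span ?S" and q: "\<And>s. s \<in> span ?S \<Longrightarrow> orthogonal q s" and b: "b = p + q"
    using orthogonal_subspace_decomp_exists[of ?S b] by metis
  have "orthogonal q (transpose A *v (A *v q))"
    by (rule q) (use span in blast)
  then have "(A *v q) \<bullet> (A *v q) = 0"
    by (metis orthogonal_def inner_commute inner_matrix_vector_transpose)
  then have "A *v p = y"
    using assms b by (simp add: matrix_vector_right_distrib)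
  moreover have "p \<in> ?S"
    using p by (simp only: span)
  ultimately show ?thesis
    by (rule that[rotated])
qed

text \<open>
  For any other solution \<open>b\<close>, the difference \<open>b - a\<close> is in the kernel of \<open>A\<close> and therefore orthogonal
  to the row-space element \<open>a\<close>, so \<open>\<parallel>b\<parallel>\<^sup>2 = \<parallel>a\<parallel>\<^sup>2 + \<parallel>b - a\<parallel>\<^sup>2\<close>.
\<close>

lemma least_norm_minimizer_row_space:
  fixes A :: "real^'m^'n"
  assumes a: "a \<in> range ((*v) (transpose A))" and Aa: "A *v a = y"
  shows "least_norm_minimizer (\<lambda>a. (norm (A *v a - y))\<^sup>2) b \<longleftrightarrow> b = a"
proof -
  have min: "is_arg_min (\<lambda>a. (norm (A *v a - y))\<^sup>2) (\<lambda>_. True) b \<longleftrightarrow> A *v b = y" for b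
  proof
    assume "is_arg_min (\<lambda>a. (norm (A *v a - y))\<^sup>2) (\<lambda>_. True) b"
    then have "\<not> (norm (A *v a - y))\<^sup>2 < (norm (A *v b - y))\<^sup>2"
      by (auto simp: is_arg_min_def)
    then show "A *v b = y"
      using Aa by simp
  next
    assume "A *v b = y"
    then show "is_arg_min (\<lambda>a. (norm (A *v a - y))\<^sup>2) (\<lambda>_. True) b"
      by (auto simp: is_arg_min_def not_less)
  qed
  have pyth: "(norm b)\<^sup>2 = (norm a)\<^sup>2 + (norm (b - a))\<^sup>2" if "A *v b = y" for b
  proof -
    obtain z where "a = transpose A *v z"
      using a by auto
    then have "a \<bullet> (b - a) = z \<bullet> (A *v (b - a))"
      by (simp add: inner_matrix_vector_transpose)
    also have "\<dots> = 0"
      using that Aa by (simp add: matrix_vector_mult_diff_distrib)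
    finally have "orthogonal a (b - a)"
      by (simp add: orthogonal_def)
    then show ?thesis
      using norm_add_Pythagorean[of a "b - a"] by simp
  qed
  show ?thesis
  proof
    assume "least_norm_minimizer (\<lambda>a. (norm (A *v a - y))\<^sup>2) b"
    then have b: "A *v b = y" and "norm b \<le> norm a"
      using Aa by (auto simp: least_norm_minimizer_def is_arg_min_def[of norm] min not_less)
    then have "(norm b)\<^sup>2 \<le> (norm a)\<^sup>2"
      by simp
    then show "b = a"
      using pyth[OF b] by simp
  next
    assume "b = a"
    moreover have "norm a \<le> norm c" if "A *v c = y" for c
      using pyth[OF that] by (intro power2_le_imp_le[of "norm a"]) auto
    ultimately show "least_norm_minimizer (\<lambda>a. (norm (A *v a - y))\<^sup>2) b"
      using Aa by (auto simp: least_norm_minimizer_def is_arg_min_def[of norm] min not_less)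
  qed
qed

lemma unique_interpolating_least_norm_iff:
  fixes A :: "real^'m^'n"
  shows "(\<exists>!a. least_norm_minimizer (\<lambda>a. (norm (A *v a - y))\<^sup>2) a \<and> (norm (A *v a - y))\<^sup>2 = 0)
    \<longleftrightarrow> (\<exists>a. A *v a = y)"
proof
  assume "\<exists>!a. least_norm_minimizer (\<lambda>a. (norm (A *v a - y))\<^sup>2) a \<and> (norm (A *v a - y))\<^sup>2 = 0"
  then show "\<exists>a. A *v a = y"
    by auto
next
  assume "\<exists>a. A *v a = y"
  then obtain a where a: "a \<in> range ((*v) (transpose A))" "A *v a = y"
    using solvable_imp_row_space_solution by metis
  then show "\<exists>!a. least_norm_minimizer (\<lambda>a. (norm (A *v a - y))\<^sup>2) a \<and> (norm (A *v a - y))\<^sup>2 = 0"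
    by (auto simp: least_norm_minimizer_row_space[OF a])
qed

text \<open>
  A suitable \<open>u\<close> is the component of \<open>y\<close> orthogonal to the column space.
\<close>

lemma unsolvable_imp_orthogonal_to_columns:
  fixes A :: "real^'m^'n"
  assumes "\<nexists>a. A *v a = y"
  obtains u where "u \<noteq> 0" "\<And>k. u \<bullet> column k A = 0"
proof -
  let ?S = "range ((*v) A)"
  have "subspace ?S"
    by (intro linear_subspace_image) auto
  then have span: "span ?S = ?S"
    by (simp add: span_eq_iff)
  obtain p q where p: "p \<in> span ?S" and q: "\<And>s. s \<in> span ?S \<Longrightarrow> orthogonal q s" and y: "y = p + q"
    using orthogonal_subspace_decomp_exists[of ?S y] by metis
  have "q \<noteq> 0"
    using assms p y by (auto simp: span)
  moreover have "q \<bullet> column k A = 0" for k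
  proof -
    have "column k A \<in> ?S"
      by (metis matrix_vector_mul_component matrix_vector_mult_basis rangeI)
    then show ?thesis
      using q[of "column k A"] span by (simp add: orthogonal_def)
  qed
  ultimately show ?thesis
    by (rule that)
qed

section \<open>Convergence of gradient descent\<close>

lemma gderiv_half_least_squares:
  fixes A :: "real^'m^'n"
  shows "GDERIV (\<lambda>a. 1/2 * (norm (A *v a - y))\<^sup>2) x :> transpose A *v (A *v x - y)"
proof -
  have lin: "bounded_linear ((*v) A)"
    by (simp add: linear_conv_bounded_linear)
  have eq: "h \<bullet> (transpose A *v (A *v x - y)) = (A *v x - y) \<bullet> (A *v h)" for h
    by (metis inner_commute inner_matrix_vector_transpose)
  have "((\<lambda>a. 1/2 * ((A *v a - y) \<bullet> (A *v a - y))) has_derivative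
      (\<lambda>h. (A *v x - y) \<bullet> (A *v h))) (at x)"
    by (rule derivative_eq_intros bounded_linear.has_derivative[OF lin] refl)+
      (auto simp: inner_commute)
  then show ?thesis
    unfolding gderiv_def eq power2_norm_eq_inner .
qed

text \<open>
  The error never leaves the row space, where \<open>A\<close> is bounded below by some \<open>B > 0\<close>. The step-size
  condition makes \<open>g = \<eta> (2 - \<eta> \<Lambda>)\<close> positive, and the squared error contracts by the factor
  \<open>1 - g B\<^sup>2 < 1\<close> in each step.
\<close>

lemma gradient_descent_tendsto_row_space_solution:
  fixes A :: "real^'m^'n"
  assumes a: "a \<in> range ((*v) (transpose A))" and Aa: "A *v a = y"
    and \<eta>: "0 < \<eta>" "\<eta> * lambda_max (A ** transpose A) < 2"
  shows "gradient_descent (\<lambda>a. 1/2 * (norm (A *v a - y))\<^sup>2) \<eta> 0 \<longlonglongrightarrow> a"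
proof -
  let ?S = "range ((*v) (transpose A))"
  define \<Lambda> where "\<Lambda> = lambda_max (A ** transpose A)"
  define e where "e k = gradient_descent (\<lambda>a. 1/2 * (norm (A *v a - y))\<^sup>2) \<eta> 0 k - a" for k
  have S: "subspace ?S"
    by (intro linear_subspace_image) auto
  have step: "e (Suc k) = e k - \<eta> *\<^sub>R (transpose A *v (A *v e k))" for k
  proof -
    have "A *v e k = A *v gradient_descent (\<lambda>a. 1/2 * (norm (A *v a - y))\<^sup>2) \<eta> 0 k - y"
      by (simp add: e_def matrix_vector_mult_diff_distrib Aa)
    then show ?thesis
      unfolding e_def gradient_descent.simps gradient_eqI[OF gderiv_half_least_squares]
      by (simp add: algebra_simps)
  qed
  have eS: "e k \<in> ?S" for k
  proof (induction k)
    case 0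
    show ?case
      using subspace_neg[OF S a] by (simp add: e_def)
  next
    case (Suc k)
    then show ?case
      unfolding step by (intro subspace_diff[OF S] subspace_mul[OF S]) auto
  qed
  have transpose_bound: "(norm (transpose A *v u))\<^sup>2 \<le> \<Lambda> * (norm u)\<^sup>2" for u
  proof -
    have "(norm (transpose A *v u))\<^sup>2 = u \<bullet> ((A ** transpose A) *v u)"
      by (simp add: power2_norm_eq_inner inner_matrix_vector_transpose flip: matrix_vector_mul_assoc)
    also have "\<dots> \<le> \<Lambda> * (norm u)\<^sup>2"
      unfolding \<Lambda>_def by (rule quadratic_form_le_lambda_max) (simp add: matrix_transpose_mul)
    finally show ?thesis .
  qed
  obtain B where B: "B > 0" "\<And>v. v \<in> ?S \<Longrightarrow> B * norm v \<le> norm (A *v v)"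
  proof -
    have "\<forall>v\<in>?S. A *v v = 0 \<longrightarrow> v = 0"
    proof clarify
      fix z assume "A *v (transpose A *v z) = 0"
      then have "(transpose A *v z) \<bullet> (transpose A *v z) = 0"
        by (metis inner_matrix_vector_transpose inner_zero_right)
      then show "transpose A *v z = 0"
        by simp
    qed
    moreover have "closed ?S"
      using S by (rule closed_subspace)
    moreover have "bounded_linear ((*v) A)"
      by (simp add: linear_conv_bounded_linear)
    ultimately show ?thesis
      using injective_imp_isometric[of ?S "(*v) A"] S that by (metis mult.commute)
  qed
  define g where "g = \<eta> * (2 - \<eta> * \<Lambda>)"
  have g: "0 < g"
    using \<eta> by (simp add: g_def \<Lambda>_def)
  \<comment> \<open>If the row space is trivial, \<open>B\<close> is arbitrary and \<open>1 - g B\<^sup>2\<close> may be negative.\<close>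
  define r where "r = max 0 (1 - g * B\<^sup>2)"
  have r: "0 \<le> r" "r < 1"
    using g B(1) by (auto simp: r_def)
  have contract: "(norm (e (Suc k)))\<^sup>2 \<le> r * (norm (e k))\<^sup>2" for k
  proof -
    let ?u = "A *v e k"
    have "(norm (e (Suc k)))\<^sup>2
        = (norm (e k))\<^sup>2 - 2 * \<eta> * (norm ?u)\<^sup>2 + \<eta>\<^sup>2 * (norm (transpose A *v ?u))\<^sup>2"
    proof -
      have "e k \<bullet> (transpose A *v ?u) = ?u \<bullet> ?u"
        by (simp add: inner_matrix_vector_transpose inner_commute)
      then show ?thesis
        unfolding step power2_norm_eq_inner
        by (simp add: inner_diff_left inner_diff_right inner_commute power2_eq_square algebra_simps)
    qed
    also have "\<dots> \<le> (norm (e k))\<^sup>2 - 2 * \<eta> * (norm ?u)\<^sup>2 + \<eta>\<^sup>2 * (\<Lambda> * (norm ?u)\<^sup>2)"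
      using transpose_bound[of ?u] by (intro add_left_mono mult_left_mono) auto
    also have "\<dots> = (norm (e k))\<^sup>2 - g * (norm ?u)\<^sup>2"
      by (simp add: g_def power2_eq_square algebra_simps)
    also have "\<dots> \<le> (norm (e k))\<^sup>2 - g * (B * norm (e k))\<^sup>2"
      using B g eS[of k] by (intro diff_left_mono mult_left_mono power_mono) auto
    also have "\<dots> \<le> r * (norm (e k))\<^sup>2"
    proof -
      have "(1 - g * B\<^sup>2) * (norm (e k))\<^sup>2 \<le> r * (norm (e k))\<^sup>2"
        by (intro mult_right_mono) (auto simp: r_def)
      then show ?thesis
        by (simp add: power_mult_distrib algebra_simps)
    qed
    finally show ?thesis .
  qed
  have "(norm (e k))\<^sup>2 \<le> r ^ k * (norm (e 0))\<^sup>2" for k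
  proof (induction k)
    case (Suc k)
    have "(norm (e (Suc k)))\<^sup>2 \<le> r * (norm (e k))\<^sup>2"
      by (rule contract)
    also have "\<dots> \<le> r * (r ^ k * (norm (e 0))\<^sup>2)"
      using Suc r by (intro mult_left_mono)
    finally show ?case
      by simp
  qed simp
  moreover have "(\<lambda>k. r ^ k * (norm (e 0))\<^sup>2) \<longlonglongrightarrow> 0"
    using r by (auto intro!: tendsto_eq_intros LIMSEQ_power_zero)
  ultimately have "(\<lambda>k. (norm (e k))\<^sup>2) \<longlonglongrightarrow> 0"
    by (rule_tac tendsto_sandwich[OF always_eventually always_eventually tendsto_const]) auto
  then have "e \<longlonglongrightarrow> 0"
    using tendsto_real_sqrt[of "\<lambda>k. (norm (e k))\<^sup>2" 0] by (simp add: tendsto_norm_zero_iff)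
  then show ?thesis
    by (simp add: e_def[abs_def] LIM_zero_iff)
qed

section \<open>Projections onto the complement of a growing span\<close>

definition orthogonal_projection :: "real^'n^'n \<Rightarrow> bool" where
  "orthogonal_projection Q \<longleftrightarrow> transpose Q = Q \<and> Q ** Q = Q"

text \<open>
  This is \<open>Q - a a\<^sup>T / \<parallel>a\<parallel>\<^sup>2\<close> with \<open>a = Q v\<close>: when \<open>Q\<close> projects onto a subspace, the result
  projects onto the part of it orthogonal to \<open>v\<close>. For \<open>Q v = 0\<close> the convention \<open>x / 0 = 0\<close>
  gives back \<open>Q\<close>, as it should. Unlike the span of a set of vectors, the entries of the result
  are visibly Borel functions of \<open>Q\<close> and \<open>v\<close>.
\<close>

definition deflate :: "real^'n^'n \<Rightarrow> real^'n \<Rightarrow> real^'n^'n" where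
  "deflate Q v = Q - (\<chi> i j. (Q *v v) $ i * (Q *v v) $ j / (norm (Q *v v))\<^sup>2)"

primrec complement_projection :: "(real^'n) list \<Rightarrow> real^'n^'n" where
  "complement_projection [] = mat 1"
| "complement_projection (v # vs) = deflate (complement_projection vs) v"

lemma orthogonal_projection_entry_sym:
  "orthogonal_projection Q \<Longrightarrow> Q $ i $ j = Q $ j $ i"
  unfolding orthogonal_projection_def by (metis transpose_def vec_lambda_beta)

lemma orthogonal_projection_idem:
  "orthogonal_projection Q \<Longrightarrow> Q *v (Q *v x) = Q *v x"
  by (simp add: orthogonal_projection_def matrix_vector_mul_assoc)

lemma orthogonal_projection_inner:
  "orthogonal_projection Q \<Longrightarrow> x \<bullet> (Q *v y) = (Q *v x) \<bullet> y"
  unfolding orthogonal_projection_def by (metis dot_lmul_matrix transpose_matrix_vector)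

lemma norm_matrix_vector_mult_squared:
  fixes A :: "real^'m^'n"
  shows "(norm (A *v x))\<^sup>2 = (\<Sum>i\<in>UNIV. (A $ i \<bullet> x)\<^sup>2)"
  unfolding power2_norm_eq_inner inner_vec_def[of "A *v x"] matrix_vector_mul_component
  by (simp add: power2_eq_square)

lemma quadratic_form_orthogonal_projection:
  assumes "orthogonal_projection Q"
  shows "(\<Sum>j\<in>UNIV. \<Sum>k\<in>UNIV. Q $ j $ k * (v $ j * v $ k)) = (norm (Q *v v))\<^sup>2"
proof -
  have "(\<Sum>j\<in>UNIV. \<Sum>k\<in>UNIV. Q $ j $ k * (v $ j * v $ k)) = v \<bullet> (Q *v v)"
    by (simp add: inner_vec_def matrix_vector_mult_def sum_distrib_left algebra_simps)
  also have "\<dots> = (Q *v v) \<bullet> (Q *v v)"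
    using assms by (metis orthogonal_projection_idem orthogonal_projection_inner)
  finally show ?thesis
    by (simp add: power2_norm_eq_inner)
qed

lemma trace_orthogonal_projection:
  assumes "orthogonal_projection Q"
  shows "trace Q = (\<Sum>i\<in>UNIV. (norm (Q $ i))\<^sup>2)"
proof -
  have "Q $ i $ i = (norm (Q $ i))\<^sup>2" for i
  proof -
    have "Q $ i $ i = (Q ** Q) $ i $ i"
      using assms by (simp add: orthogonal_projection_def)
    also have "\<dots> = Q $ i \<bullet> Q $ i"
      using orthogonal_projection_entry_sym[OF assms, of _ i]
      by (simp add: matrix_matrix_mult_def inner_vec_def)
    finally show ?thesis
      by (simp add: power2_norm_eq_inner)
  qed
  then show ?thesis
    by (simp add: trace_def)
qed

text \<open>
  Cauchy--Schwarz applied to \<open>\<parallel>Q x\<parallel>\<^sup>2 = Q x \<bullet> x\<close>.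
\<close>

lemma norm_orthogonal_projection_le:
  assumes "orthogonal_projection Q"
  shows "norm (Q *v x) \<le> norm x"
proof (cases "Q *v x = 0")
  case False
  have "(norm (Q *v x))\<^sup>2 = (Q *v x) \<bullet> x"
    using orthogonal_projection_inner[OF assms, of "Q *v x" x]
    by (simp add: power2_norm_eq_inner orthogonal_projection_idem[OF assms])
  also have "\<dots> \<le> norm (Q *v x) * norm x"
    by (rule norm_cauchy_schwarz)
  finally show ?thesis
    using False by (simp add: power2_eq_square)
qed simp

lemma orthogonal_projection_entry_bound:
  assumes "orthogonal_projection Q"
  shows "\<bar>Q $ i $ j\<bar> \<le> 1"
proof -
  let ?e = "axis j 1 :: real^'a"
  have "norm (Q *v ?e) \<le> 1"
    using norm_orthogonal_projection_le[OF assms, of ?e] by simp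
  moreover have "(Q *v ?e) $ i = Q $ i $ j"
    by (simp add: matrix_vector_mul_component inner_axis)
  ultimately show ?thesis
    using component_le_norm_cart[of "Q *v ?e" i] by simp
qed

lemma deflate_mult:
  "deflate Q v *v x = Q *v x - (((Q *v v) \<bullet> x) / (norm (Q *v v))\<^sup>2) *\<^sub>R (Q *v v)"
  by (simp add: deflate_def matrix_vector_mult_diff_rdistrib)
    (simp add: vec_eq_iff matrix_vector_mult_def inner_vec_def sum_distrib_left sum_divide_distrib
      algebra_simps)

text \<open>
  The vector \<open>a = Q v\<close> is fixed by \<open>Q\<close>, and deflation makes every image orthogonal to \<open>a\<close>, so a second
  application subtracts nothing more.
\<close>

lemma orthogonal_projection_deflate:
  assumes Q: "orthogonal_projection Q"
  shows "orthogonal_projection (deflate Q v)"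
  unfolding orthogonal_projection_def
proof
  have "Q $ j $ i = Q $ i $ j" for i j
    using Q by (rule orthogonal_projection_entry_sym)
  then show "transpose (deflate Q v) = deflate Q v"
    by (simp add: deflate_def transpose_def vec_eq_iff mult.commute)
  define a where "a = Q *v v"
  have a: "Q *v a = a"
    using Q by (simp add: a_def orthogonal_projection_idem)
  have D: "deflate Q v *v x = Q *v x - ((a \<bullet> x) / (norm a)\<^sup>2) *\<^sub>R a" for x
    by (simp add: deflate_mult a_def)
  have "deflate Q v *v (deflate Q v *v x) = deflate Q v *v x" for x
  proof -
    have "a \<bullet> (Q *v x) = a \<bullet> x"
      using Q by (simp add: orthogonal_projection_inner a)
    then have "a \<bullet> (deflate Q v *v x) = 0"
      by (simp add: D inner_diff_right power2_norm_eq_inner)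
    then have "deflate Q v *v (deflate Q v *v x) = Q *v (deflate Q v *v x)"
      using D by simp
    also have "\<dots> = deflate Q v *v x"
      using Q by (simp add: D matrix_vector_mult_diff_distrib matrix_vector_mult_scaleR a
          orthogonal_projection_idem)
    finally show ?thesis .
  qed
  then show "deflate Q v ** deflate Q v = deflate Q v"
    by (simp add: matrix_eq flip: matrix_vector_mul_assoc)
qed

lemma trace_deflate:
  "trace (deflate Q v) = trace Q - (if Q *v v = 0 then 0 else 1)"
proof -
  have "(\<Sum>i\<in>UNIV. (Q *v v) $ i * (Q *v v) $ i / (norm (Q *v v))\<^sup>2)
      = (norm (Q *v v))\<^sup>2 / (norm (Q *v v))\<^sup>2"
    by (simp add: power2_norm_eq_inner inner_vec_def flip: sum_divide_distrib)
  then show ?thesis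
    by (simp add: deflate_def trace_def sum_subtractf)
qed

lemma orthogonal_projection_complement_projection:
  "orthogonal_projection (complement_projection vs)"
proof (induction vs)
  case Nil
  show ?case
    by (simp add: orthogonal_projection_def)
next
  case (Cons v vs)
  then show ?case
    by (simp add: orthogonal_projection_deflate)
qed

lemma complement_projection_fixes:
  assumes "\<And>v. v \<in> set vs \<Longrightarrow> u \<bullet> v = 0"
  shows "complement_projection vs *v u = u"
  using assms
proof (induction vs)
  case (Cons v vs)
  let ?Q = "complement_projection vs"
  have "?Q *v u = u"
    using Cons by simp
  moreover from this have "(?Q *v v) \<bullet> u = 0"
    using Cons.prems[of v]
      orthogonal_projection_inner[OF orthogonal_projection_complement_projection, of v vs u]
    by (simp add: inner_commute)
  ultimately show ?case
    by (simp add: deflate_mult)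
qed simp

text \<open>
  If the vectors do not span, the projection fixes some \<open>u \<noteq> 0\<close>. The trace of a projection is its squared
  Frobenius norm, which dominates the squared operator norm, here at least \<open>1\<close>.
\<close>

lemma trace_complement_projection_ge_1:
  assumes "u \<noteq> 0" and orth: "\<And>v. v \<in> set vs \<Longrightarrow> u \<bullet> v = 0"
  shows "1 \<le> trace (complement_projection vs)"
proof -
  let ?Q = "complement_projection vs"
  have "(norm u)\<^sup>2 = (norm (?Q *v u))\<^sup>2"
    using orth by (simp add: complement_projection_fixes)
  also have "\<dots> = (\<Sum>i\<in>UNIV. (?Q $ i \<bullet> u)\<^sup>2)"
    by (rule norm_matrix_vector_mult_squared)
  also have "\<dots> \<le> (\<Sum>i\<in>UNIV. (norm (?Q $ i))\<^sup>2 * (norm u)\<^sup>2)"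
    by (intro sum_mono) (metis Cauchy_Schwarz_ineq power2_norm_eq_inner)
  also have "\<dots> = trace ?Q * (norm u)\<^sup>2"
    by (simp add: trace_orthogonal_projection orthogonal_projection_complement_projection
        sum_distrib_right)
  finally show ?thesis
    using \<open>u \<noteq> 0\<close> by simp
qed

section \<open>Independent vectors fail to span with exponentially small probability\<close>

lemma borel_measurable_vecI:
  fixes f :: "'a \<Rightarrow> 'b::euclidean_space^'n"
  assumes "\<And>i. (\<lambda>x. f x $ i) \<in> borel_measurable N"
  shows "f \<in> borel_measurable N"
proof -
  have "(\<lambda>x. f x \<bullet> b) \<in> borel_measurable N" if "b \<in> Basis" for b
  proof -
    obtain i u where b: "b = axis i u"
      using \<open>b \<in> Basis\<close> unfolding Basis_vec_def by blast
    then show ?thesis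
      using assms[of i] by (simp add: b inner_axis)
  qed
  then show ?thesis
    by (subst borel_measurable_euclidean_space) auto
qed

lemma borel_measurable_vec_nth [measurable (raw)]:
  fixes f :: "'a \<Rightarrow> 'b::euclidean_space^'n"
  assumes [measurable]: "f \<in> borel_measurable N"
  shows "(\<lambda>x. f x $ i) \<in> borel_measurable N"
proof (rule measurable_compose[OF assms])
  show "(\<lambda>x::'b^'n. x $ i) \<in> borel_measurable borel"
    by (intro borel_measurable_continuous_onI continuous_intros)
qed

lemma borel_measurable_deflate:
  fixes Q :: "'a \<Rightarrow> real^'n^'n"
  assumes [measurable]: "Q \<in> borel_measurable N" "v \<in> borel_measurable N"
  shows "(\<lambda>x. deflate (Q x) (v x)) \<in> borel_measurable N"
proof -
  have [measurable]: "(\<lambda>x. Q x *v v x) \<in> borel_measurable N"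
    by (rule borel_measurable_vecI) (simp add: matrix_vector_mult_def)
  show ?thesis
    by (intro borel_measurable_vecI) (simp add: deflate_def)
qed

lemma borel_measurable_complement_projection:
  assumes "\<And>k. k \<in> set ks \<Longrightarrow> V k \<in> borel_measurable N"
  shows "(\<lambda>x. complement_projection (map (\<lambda>k. V k x) ks)) \<in> borel_measurable N"
  using assms by (induction ks) (auto intro!: borel_measurable_deflate)

text \<open>
  One draw of the coupon collector. The trace drops by the indicator of \<open>Q v \<noteq> 0\<close>, which is at least
  \<open>\<parallel>Q v\<parallel>\<^sup>2 / R\<close> because \<open>\<parallel>Q v\<parallel> \<le> \<parallel>v\<parallel>\<close>. As \<open>\<parallel>Q v\<parallel>\<^sup>2\<close> is the sum of the products
  \<open>Q\<^sub>i\<^sub>j v\<^sub>i v\<^sub>j\<close> and \<open>Q\<close> is independent of \<open>v\<close>, its expectation is that of \<open>tr (Q S)\<close> with \<open>S = E v v\<^sup>T\<close>.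
  This way of using independence avoids conditional expectations.
\<close>

lemma (in prob_space) trace_complement_projection_expectation_step:
  fixes V :: "'k \<Rightarrow> 'a \<Rightarrow> real^'n"
  assumes indep: "indep_vars (\<lambda>_. borel) V I"
    and k: "k \<in> I" "k \<notin> set ks" and ks: "set ks \<subseteq> I"
    and bound: "AE \<omega> in M. (norm (V k \<omega>))\<^sup>2 \<le> R" and R: "R > 0"
    and energy: "\<And>x. \<kappa> * (norm x)\<^sup>2 \<le> expectation (\<lambda>\<omega>. (x \<bullet> V k \<omega>)\<^sup>2)"
  defines "Q \<equiv> \<lambda>\<omega>. complement_projection (map (\<lambda>j. V j \<omega>) ks)"
  shows "expectation (\<lambda>\<omega>. trace (deflate (Q \<omega>) (V k \<omega>)))
    \<le> (1 - \<kappa> / R) * expectation (\<lambda>\<omega>. trace (Q \<omega>))"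
proof -
  have meas: "V j \<in> borel_measurable M" if "j \<in> I" for j
    using indep that by (auto simp: indep_vars_def)
  have Vk [measurable]: "V k \<in> borel_measurable M"
    using k meas by blast
  have Qm [measurable]: "Q \<in> borel_measurable M"
    unfolding Q_def using ks meas by (intro borel_measurable_complement_projection) auto
  have Q: "orthogonal_projection (Q \<omega>)" for \<omega>
    by (simp add: Q_def orthogonal_projection_complement_projection)
  have int_Q: "integrable M (\<lambda>\<omega>. Q \<omega> $ i $ j)" for i j
    by (rule integrable_const_bound[where B=1])
      (auto intro!: AE_I2 orthogonal_projection_entry_bound[OF Q])
  have entry: "AE \<omega> in M. \<bar>V k \<omega> $ i\<bar> \<le> sqrt R" for i
    using bound
  proof eventually_elim
    case (elim \<omega>)
    have "norm (V k \<omega>) \<le> sqrt R"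
      using elim by (rule real_le_rsqrt)
    then show ?case
      using component_le_norm_cart[of "V k \<omega>" i] by simp
  qed
  have int_V: "integrable M (\<lambda>\<omega>. V k \<omega> $ i * V k \<omega> $ j)" for i j
  proof (rule integrable_const_bound[where B=R])
    show "AE \<omega> in M. norm (V k \<omega> $ i * V k \<omega> $ j) \<le> R"
      using entry[of i] entry[of j]
    proof eventually_elim
      case (elim \<omega>)
      then have "\<bar>V k \<omega> $ i\<bar> * \<bar>V k \<omega> $ j\<bar> \<le> sqrt R * sqrt R"
        using R by (intro mult_mono) auto
      then show ?case
        using R by (simp add: abs_mult)
    qed
  qed measurable
  define S where "S i j = expectation (\<lambda>\<omega>. V k \<omega> $ i * V k \<omega> $ j)" for i j
  have indep_entry: "indep_var borel (\<lambda>\<omega>. Q \<omega> $ i $ j) borel (\<lambda>\<omega>. V k \<omega> $ i * V k \<omega> $ j)" for i j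
  proof -
    let ?f = "\<lambda>z. complement_projection (map z ks) $ i $ j"
    let ?g = "\<lambda>z::'k \<Rightarrow> real^'n. z k $ i * z k $ j"
    have "indep_var (PiM (set ks) (\<lambda>_. borel)) (\<lambda>\<omega>. restrict (\<lambda>i. V i \<omega>) (set ks))
        (PiM {k} (\<lambda>_. borel)) (\<lambda>\<omega>. restrict (\<lambda>i. V i \<omega>) {k})"
      using k ks by (intro indep_var_restrict[OF indep]) auto
    moreover have "?f \<in> borel_measurable (PiM (set ks) (\<lambda>_. borel))"
      by (intro borel_measurable_vec_nth
          borel_measurable_complement_projection[where V="\<lambda>k z. z k"] measurable_component_singleton)
    moreover have "?g \<in> borel_measurable (PiM {k} (\<lambda>_. borel))"
      by (intro borel_measurable_times borel_measurable_vec_nth measurable_component_singleton) simp_all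
    ultimately have "indep_var borel (?f \<circ> (\<lambda>\<omega>. restrict (\<lambda>i. V i \<omega>) (set ks)))
        borel (?g \<circ> (\<lambda>\<omega>. restrict (\<lambda>i. V i \<omega>) {k}))"
      by (rule indep_var_compose)
    moreover have "map (restrict (\<lambda>i. V i \<omega>) (set ks)) ks = map (\<lambda>i. V i \<omega>) ks" for \<omega>
      by (rule map_cong) auto
    ultimately show ?thesis
      by (simp add: comp_def Q_def)
  qed
  \<comment> \<open>For a fixed projection with rows \<open>p\<^sub>l\<close>: the sum of \<open>E (p\<^sub>l \<bullet> v)\<^sup>2\<close> is at least \<open>\<kappa>\<close> times
    the sum of \<open>\<parallel>p\<^sub>l\<parallel>\<^sup>2\<close>, and these two sums are \<open>tr (P S)\<close> and \<open>tr P\<close>.\<close>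
  have energy_trace: "\<kappa> * trace P \<le> (\<Sum>i\<in>UNIV. \<Sum>j\<in>UNIV. P $ i $ j * S i j)"
    if P: "orthogonal_projection P" for P :: "real^'n^'n"
  proof -
    have sq: "(P $ l \<bullet> V k \<omega>)\<^sup>2
        = (\<Sum>i\<in>UNIV. \<Sum>j\<in>UNIV. P $ l $ i * P $ l $ j * (V k \<omega> $ i * V k \<omega> $ j))" for l \<omega>
      by (simp add: inner_vec_def power2_eq_square sum_product algebra_simps)
    have "\<kappa> * trace P = (\<Sum>l\<in>UNIV. \<kappa> * (norm (P $ l))\<^sup>2)"
      using P by (simp add: trace_orthogonal_projection sum_distrib_left)
    also have "\<dots> \<le> (\<Sum>l\<in>UNIV. expectation (\<lambda>\<omega>. (P $ l \<bullet> V k \<omega>)\<^sup>2))"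
      by (intro sum_mono energy)
    also have "\<dots> = expectation (\<lambda>\<omega>. \<Sum>l\<in>UNIV. (P $ l \<bullet> V k \<omega>)\<^sup>2)"
      unfolding sq by (intro Bochner_Integration.integral_sum[symmetric]
          Bochner_Integration.integrable_sum integrable_mult_right int_V)
    also have "\<dots> = expectation (\<lambda>\<omega>. (norm (P *v V k \<omega>))\<^sup>2)"
      by (simp add: norm_matrix_vector_mult_squared)
    also have "\<dots> = expectation (\<lambda>\<omega>. \<Sum>i\<in>UNIV. \<Sum>j\<in>UNIV. P $ i $ j * (V k \<omega> $ i * V k \<omega> $ j))"
      using P by (simp add: quadratic_form_orthogonal_projection)
    also have "\<dots> = (\<Sum>i\<in>UNIV. \<Sum>j\<in>UNIV. P $ i $ j * S i j)"
      using int_V by (simp add: S_def)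
    finally show ?thesis .
  qed
  have int_QV: "integrable M (\<lambda>\<omega>. Q \<omega> $ i $ j * (V k \<omega> $ i * V k \<omega> $ j))" for i j
    by (rule indep_var_integrable[OF indep_entry int_Q int_V])
  have int_trace: "integrable M (\<lambda>\<omega>. trace (Q \<omega>))"
    unfolding trace_def by (intro Bochner_Integration.integrable_sum int_Q)
  have int_norm: "integrable M (\<lambda>\<omega>. (norm (Q \<omega> *v V k \<omega>))\<^sup>2)"
    using int_QV by (simp flip: quadratic_form_orthogonal_projection[OF Q])
  have int_deflate: "integrable M (\<lambda>\<omega>. trace (deflate (Q \<omega>) (V k \<omega>)))"
    unfolding trace_def
    by (intro Bochner_Integration.integrable_sum integrable_const_bound[where B=1] AE_I2
        borel_measurable_vec_nth borel_measurable_deflate Qm Vk)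
      (auto intro!: orthogonal_projection_entry_bound orthogonal_projection_deflate Q)
  have "\<kappa> * expectation (\<lambda>\<omega>. trace (Q \<omega>)) = expectation (\<lambda>\<omega>. \<kappa> * trace (Q \<omega>))"
    by simp
  also have "\<dots> \<le> expectation (\<lambda>\<omega>. \<Sum>i\<in>UNIV. \<Sum>j\<in>UNIV. Q \<omega> $ i $ j * S i j)"
    using int_Q int_trace by (intro integral_mono energy_trace Q) auto
  also have "\<dots> = (\<Sum>i\<in>UNIV. \<Sum>j\<in>UNIV. expectation (\<lambda>\<omega>. Q \<omega> $ i $ j) * S i j)"
    using int_Q by simp
  also have "\<dots> = (\<Sum>i\<in>UNIV. \<Sum>j\<in>UNIV. expectation (\<lambda>\<omega>. Q \<omega> $ i $ j * (V k \<omega> $ i * V k \<omega> $ j)))"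
    unfolding S_def by (intro sum.cong refl indep_var_lebesgue_integral[symmetric] int_Q int_V indep_entry)
  also have "\<dots> = expectation (\<lambda>\<omega>. (norm (Q \<omega> *v V k \<omega>))\<^sup>2)"
    using int_QV by (simp flip: quadratic_form_orthogonal_projection[OF Q])
  finally have gain: "\<kappa> * expectation (\<lambda>\<omega>. trace (Q \<omega>)) \<le> expectation (\<lambda>\<omega>. (norm (Q \<omega> *v V k \<omega>))\<^sup>2)" .
  have "expectation (\<lambda>\<omega>. trace (deflate (Q \<omega>) (V k \<omega>)))
      \<le> expectation (\<lambda>\<omega>. trace (Q \<omega>) - (norm (Q \<omega> *v V k \<omega>))\<^sup>2 / R)"
  proof (rule integral_mono_AE)
    show "AE \<omega> in M. trace (deflate (Q \<omega>) (V k \<omega>)) \<le> trace (Q \<omega>) - (norm (Q \<omega> *v V k \<omega>))\<^sup>2 / R"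
      using bound
    proof eventually_elim
      case (elim \<omega>)
      let ?a = "Q \<omega> *v V k \<omega>"
      have "(norm ?a)\<^sup>2 \<le> (norm (V k \<omega>))\<^sup>2"
        by (intro power_mono norm_orthogonal_projection_le Q norm_ge_zero)
      with elim have "(norm ?a)\<^sup>2 \<le> R"
        by linarith
      then show ?case
        using R by (simp add: trace_deflate)
    qed
  qed (use int_deflate int_trace int_norm in auto)
  also have "\<dots> = expectation (\<lambda>\<omega>. trace (Q \<omega>)) - expectation (\<lambda>\<omega>. (norm (Q \<omega> *v V k \<omega>))\<^sup>2) / R"
    using int_trace int_norm by simp
  also have "\<dots> \<le> expectation (\<lambda>\<omega>. trace (Q \<omega>)) - \<kappa> * expectation (\<lambda>\<omega>. trace (Q \<omega>)) / R"
    using gain R by (simp add: divide_right_mono)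
  finally show ?thesis
    by (simp add: algebra_simps)
qed

text \<open>
  Comparing both bounds along a coordinate direction shows that the factor \<open>1 - \<kappa> / R\<close> is nonnegative,
  and that \<open>R\<close> is positive as soon as \<open>\<kappa>\<close> is.
\<close>

lemma (in prob_space) energy_le_square_bound:
  fixes V :: "'a \<Rightarrow> real^'n"
  assumes [measurable]: "V \<in> borel_measurable M"
    and bound: "AE \<omega> in M. (norm (V \<omega>))\<^sup>2 \<le> R"
    and energy: "\<And>x. \<kappa> * (norm x)\<^sup>2 \<le> expectation (\<lambda>\<omega>. (x \<bullet> V \<omega>)\<^sup>2)"
  shows "\<kappa> \<le> R"
proof -
  let ?e = "axis undefined 1 :: real^'n"
  have "AE \<omega> in M. 0 \<le> R"
    using bound by eventually_elim (meson order_trans zero_le_power2)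
  then have R: "0 \<le> R"
    by simp
  have "\<kappa> \<le> expectation (\<lambda>\<omega>. (?e \<bullet> V \<omega>)\<^sup>2)"
    using energy[of ?e] by simp
  also have "\<dots> \<le> expectation (\<lambda>_. R)"
  proof (rule integral_mono_AE')
    show "AE \<omega> in M. (?e \<bullet> V \<omega>)\<^sup>2 \<le> R"
      using bound
    proof eventually_elim
      case (elim \<omega>)
      have "(?e \<bullet> V \<omega>)\<^sup>2 \<le> (norm (V \<omega>))\<^sup>2"
        using Cauchy_Schwarz_ineq[of ?e "V \<omega>"] by (simp flip: power2_norm_eq_inner)
      with elim show ?case
        by simp
    qed
  qed (use R in auto)
  finally show ?thesis
    by (simp add: prob_space)
qed

text \<open>
  The expected missing dimension starts at \<open>n\<close> and shrinks by the factor \<open>1 - \<kappa> / R\<close> with each vector.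
  It dominates the probability of any event on which the vectors do not span. Quantifying over such
  events \<open>E\<close> spares a proof that non-spanning is itself measurable.
\<close>

lemma (in prob_space) prob_not_spanning_le:
  fixes V :: "'k::finite \<Rightarrow> 'a \<Rightarrow> real^'n"
  assumes indep: "indep_vars (\<lambda>_. borel) V UNIV"
    and bound: "\<And>k. AE \<omega> in M. (norm (V k \<omega>))\<^sup>2 \<le> R" and "R > 0"
    and energy: "\<And>k x. \<kappa> * (norm x)\<^sup>2 \<le> expectation (\<lambda>\<omega>. (x \<bullet> V k \<omega>)\<^sup>2)"
    and E: "E \<in> events" "\<And>\<omega>. \<omega> \<in> E \<Longrightarrow> \<exists>u. u \<noteq> 0 \<and> (\<forall>k. u \<bullet> V k \<omega> = 0)"
  shows "prob E \<le> real CARD('n) * exp (- (\<kappa> * real CARD('k) / R))"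
proof -
  have meas [measurable]: "V k \<in> borel_measurable M" for k
    using indep by (auto simp: indep_vars_def)
  define Q where "Q ks \<omega> = complement_projection (map (\<lambda>j. V j \<omega>) ks)" for ks \<omega>
  have Qm: "Q ks \<in> borel_measurable M" for ks
    unfolding Q_def by (intro borel_measurable_complement_projection meas)
  have Q: "orthogonal_projection (Q ks \<omega>)" for ks \<omega>
    by (simp add: Q_def orthogonal_projection_complement_projection)
  have "\<kappa> \<le> R"
    by (rule energy_le_square_bound[OF meas bound energy])
  then have p: "0 \<le> 1 - \<kappa> / R"
    using \<open>R > 0\<close> by simp
  have trace: "expectation (\<lambda>\<omega>. trace (Q ks \<omega>)) \<le> real CARD('n) * (1 - \<kappa> / R) ^ length ks"
    if "distinct ks" for ks
    using that
  proof (induction ks)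
    case Nil
    show ?case
      by (simp add: Q_def prob_space trace_I)
  next
    case (Cons k ks)
    have "expectation (\<lambda>\<omega>. trace (Q (k # ks) \<omega>)) \<le> (1 - \<kappa> / R) * expectation (\<lambda>\<omega>. trace (Q ks \<omega>))"
      unfolding Q_def list.map complement_projection.simps
      by (rule trace_complement_projection_expectation_step[OF indep _ _ _ bound \<open>R > 0\<close> energy])
        (use Cons.prems in simp_all)
    also have "\<dots> \<le> (1 - \<kappa> / R) * (real CARD('n) * (1 - \<kappa> / R) ^ length ks)"
      using Cons p by (intro mult_left_mono) auto
    finally show ?case
      by (simp add: algebra_simps)
  qed
  obtain ks :: "'k list" where ks: "set ks = UNIV" "distinct ks"
    using finite_distinct_list[OF finite_class.finite_UNIV] by blast
  have "prob E = expectation (indicator E)"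
    using E(1) by (simp add: Int_absorb2 sets.sets_into_space)
  also have "\<dots> \<le> expectation (\<lambda>\<omega>. trace (Q ks \<omega>))"
  proof (rule integral_mono)
    show "integrable M (indicator E :: 'a \<Rightarrow> real)"
      using E(1) by (simp add: integrable_indicator_iff emeasure_eq_measure)
    show "integrable M (\<lambda>\<omega>. trace (Q ks \<omega>))"
      unfolding trace_def
      by (intro Bochner_Integration.integrable_sum integrable_const_bound[where B=1] AE_I2
          borel_measurable_vec_nth Qm) (auto intro!: orthogonal_projection_entry_bound Q)
    show "indicator E \<omega> \<le> trace (Q ks \<omega>)" if "\<omega> \<in> space M" for \<omega>
    proof (cases "\<omega> \<in> E")
      case True
      then obtain u where "u \<noteq> 0" "\<forall>k. u \<bullet> V k \<omega> = 0"
        using E(2) by blast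
      then show ?thesis
        using True unfolding Q_def by (auto intro!: trace_complement_projection_ge_1)
    next
      case False
      then show ?thesis
        by (simp add: trace_orthogonal_projection[OF Q] sum_nonneg)
    qed
  qed
  also have "\<dots> \<le> real CARD('n) * (1 - \<kappa> / R) ^ CARD('k)"
    using trace[OF ks(2)] distinct_card[OF ks(2)] ks(1) by simp
  also have "(1 - \<kappa> / R) ^ CARD('k) \<le> exp (- (\<kappa> / R)) ^ CARD('k)"
    using p exp_ge_add_one_self[of "- (\<kappa> / R)"] by (intro power_mono) simp_all
  also have "exp (- (\<kappa> / R)) ^ CARD('k) = exp (- (\<kappa> * real CARD('k) / R))"
    by (simp add: mult.commute flip: exp_of_nat_mult)
  finally show ?thesis
    by simp
qed

section \<open>Random features\<close>

text \<open>
  Solvability by a vector of norm at most \<open>N\<close> is a closed condition on \<open>A\<close>, as the projection of a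
  closed set along a compact ball; solvability is the countable union of these conditions.
\<close>

lemma borel_solvable_systems:
  "{A :: real^'m^'n. \<exists>a. A *v a = y} \<in> sets borel"
proof -
  let ?T = "{p :: (real^'m) \<times> (real^'m^'n). snd p *v fst p = y}"
  have "closed ?T"
    unfolding matrix_vector_mult_def by (intro closed_Collect_eq continuous_intros)
  then have "closed {A. \<exists>a. a \<in> cball 0 (real N) \<and> (a, A) \<in> ?T}" for N
    by (intro closed_compact_projection) auto
  then have "(\<Union>N. {A. \<exists>a. a \<in> cball 0 (real N) \<and> (a, A) \<in> ?T}) \<in> sets borel"
    by (intro sets.countable_UN) auto
  also have "(\<Union>N. {A. \<exists>a. a \<in> cball 0 (real N) \<and> (a, A) \<in> ?T}) = {A. \<exists>a. A *v a = y}"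
  proof -
    have "\<exists>N a'. norm a' \<le> real N \<and> A *v a' = A *v a" for A :: "real^'m^'n" and a
      using real_arch_simple[of "norm a"] by blast
    then show ?thesis
      by auto
  qed
  finally show ?thesis .
qed

definition feature_vector :: "(real \<Rightarrow> real) \<Rightarrow> real^'n^'d \<Rightarrow> real^'d \<Rightarrow> real^'n" where
  "feature_vector \<gamma> X w = (\<chi> i. \<gamma> (column i X \<bullet> w))"

definition feature_matrix :: "(real \<Rightarrow> real) \<Rightarrow> real^'n^'d \<Rightarrow> real^'m^'d \<Rightarrow> real^'m^'n" where
  "feature_matrix \<gamma> X W = (1 / sqrt (real CARD('m))) *\<^sub>R map_matrix \<gamma> (transpose X ** W)"

lemma feature_matrix_nth:
  fixes W :: "real^'m^'d"
  shows "feature_matrix \<gamma> X W $ i $ k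
    = (1 / sqrt (real CARD('m))) * feature_vector \<gamma> X (column k W) $ i"
  by (simp add: feature_matrix_def feature_vector_def map_matrix_def matrix_matrix_mult_def
      transpose_def column_def inner_vec_def)

lemma column_feature_matrix:
  fixes W :: "real^'m^'d"
  shows "column k (feature_matrix \<gamma> X W)
    = (1 / sqrt (real CARD('m))) *\<^sub>R feature_vector \<gamma> X (column k W)"
  by (simp add: vec_eq_iff column_def[of k "feature_matrix \<gamma> X W"] feature_matrix_nth)

lemma empirical_gram_eq:
  "empirical_gram \<gamma> X W = feature_matrix \<gamma> X W ** transpose (feature_matrix \<gamma> X W)"
  by (simp add: vec_eq_iff empirical_gram_def matrix_matrix_mult_def[of "feature_matrix \<gamma> X W"]
      transpose_def feature_matrix_nth feature_vector_def inner_commute field_simps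
      flip: sum_divide_distrib)

lemma borel_measurable_feature_vector:
  assumes "continuous_on UNIV \<gamma>"
  shows "feature_vector \<gamma> X \<in> borel_measurable borel"
  unfolding feature_vector_def
  by (intro borel_measurable_continuous_onI continuous_intros continuous_on_compose2[OF assms]) auto

lemma norm_feature_vector_squared_le:
  fixes X :: "real^'n^'d"
  assumes unit: "\<And>i. norm (column i X) = 1" and bound: "\<And>z. z \<in> {-1..1} \<Longrightarrow> \<bar>\<gamma> z\<bar> \<le> C"
    and w: "norm w = 1"
  shows "(norm (feature_vector \<gamma> X w))\<^sup>2 \<le> real CARD('n) * C\<^sup>2"
proof -
  have "(\<gamma> (column i X \<bullet> w))\<^sup>2 \<le> C\<^sup>2" for i
  proof -
    have "\<bar>column i X \<bullet> w\<bar> \<le> 1"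
      using Cauchy_Schwarz_ineq2[of "column i X" w] unit w by simp
    then have "\<bar>\<gamma> (column i X \<bullet> w)\<bar> \<le> C"
      by (intro bound) auto
    then show ?thesis
      by (simp add: abs_le_square_iff[symmetric])
  qed
  then have "(\<Sum>i\<in>UNIV. (\<gamma> (column i X \<bullet> w))\<^sup>2) \<le> (\<Sum>i\<in>(UNIV :: 'n set). C\<^sup>2)"
    by (intro sum_mono)
  then show ?thesis
    by (simp add: power2_norm_eq_inner inner_vec_def feature_vector_def flip: power2_eq_square)
qed

lemma expected_gram_quadratic_form:
  fixes X :: "real^'n^'d"
  assumes cont: "continuous_on UNIV \<gamma>"
    and bound: "AE w in uniform_sphere. (norm (feature_vector \<gamma> X w))\<^sup>2 \<le> R"
  shows "x \<bullet> (expected_gram \<gamma> X *v x) = (\<integral>w. (x \<bullet> feature_vector \<gamma> X w)\<^sup>2 \<partial>uniform_sphere)"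
proof -
  let ?f = "feature_vector \<gamma> X"
  interpret prob_space "uniform_sphere :: (real^'d) measure"
    by (rule prob_space_uniform_sphere)
  have [measurable]: "?f \<in> borel_measurable uniform_sphere"
    using borel_measurable_feature_vector[OF cont]
    by (simp add: uniform_sphere_def cong: measurable_cong_sets)
  have int: "integrable uniform_sphere (\<lambda>w. ?f w $ i * ?f w $ j)" for i j
  proof (rule integrable_const_bound[where B=R])
    show "AE w in uniform_sphere. norm (?f w $ i * ?f w $ j) \<le> R"
      using bound
    proof eventually_elim
      case (elim w)
      have "\<bar>?f w $ i\<bar> * \<bar>?f w $ j\<bar> \<le> norm (?f w) * norm (?f w)"
        by (intro mult_mono component_le_norm_cart) auto
      then show ?case
        using elim by (simp add: abs_mult power2_eq_square)
    qed
  qed measurable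
  have "(\<integral>w. (x \<bullet> ?f w)\<^sup>2 \<partial>uniform_sphere)
      = (\<integral>w. (\<Sum>i\<in>UNIV. \<Sum>j\<in>UNIV. x $ i * x $ j * (?f w $ i * ?f w $ j)) \<partial>uniform_sphere)"
    by (simp add: inner_vec_def power2_eq_square sum_product algebra_simps)
  also have "\<dots> = (\<Sum>i\<in>UNIV. \<Sum>j\<in>UNIV. x $ i * x $ j * expected_gram \<gamma> X $ i $ j)"
    using int by (simp add: expected_gram_def feature_vector_def inner_commute)
  also have "\<dots> = x \<bullet> (expected_gram \<gamma> X *v x)"
    by (simp add: inner_vec_def matrix_vector_mult_def sum_distrib_left algebra_simps)
  finally show ?thesis
    by simp
qed

lemma transpose_expected_gram: "transpose (expected_gram \<gamma> X) = expected_gram \<gamma> X"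
  by (simp add: transpose_def expected_gram_def inner_commute mult.commute)

section \<open>Interpolation and gradient descent with random features\<close>

theorem theorem4p3:
  fixes X :: "real^'n^'d" and y :: "real^'n"
    and \<gamma> :: "real \<Rightarrow> real" and L C \<delta> :: real
    and M :: "'a measure" and W :: "'a \<Rightarrow> real^'m^'d"
  assumes unit: "\<And>i. norm (column i X) = 1"
    and distinct: "\<And>i j. i \<noteq> j \<Longrightarrow> column i X \<noteq> column j X"
    and lipschitz: "L-lipschitz_on UNIV \<gamma>"
    and bound: "\<And>z. z \<in> {-1..1} \<Longrightarrow> \<bar>\<gamma> z\<bar> \<le> C"
    and lambda_min_pos: "lambda_min (expected_gram \<gamma> X) > 0"
    and delta: "0 < \<delta>" "\<delta> < 1"
    and m: "real CARD('m) \<ge> 10 * real CARD('n) * C\<^sup>2 * ln (2 * real CARD('n) / \<delta>)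
              / lambda_min (expected_gram \<gamma> X)"
    and M: "prob_space M"
    and indep: "prob_space.indep_vars M (\<lambda>_. borel) (\<lambda>k \<omega>. column k (W \<omega>)) UNIV"
    and uniform: "\<And>k. distr M borel (\<lambda>\<omega>. column k (W \<omega>)) = uniform_sphere"
  shows "\<P>(\<omega> in M. \<exists>!\<alpha>. least_norm_minimizer (\<lambda>a. (norm (residual \<gamma> X y (W \<omega>) a))\<^sup>2) \<alpha>
                     \<and> (norm (residual \<gamma> X y (W \<omega>) \<alpha>))\<^sup>2 = 0) \<ge> 1 - \<delta>
    \<and> (\<forall>\<omega>\<in>space M.
         (\<exists>!\<alpha>. least_norm_minimizer (\<lambda>a. (norm (residual \<gamma> X y (W \<omega>) a))\<^sup>2) \<alpha>
             \<and> (norm (residual \<gamma> X y (W \<omega>) \<alpha>))\<^sup>2 = 0) \<longrightarrow>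
         (\<forall>\<eta>. 0 < \<eta> \<and> \<eta> < 2 / lambda_max (empirical_gram \<gamma> X (W \<omega>)) \<longrightarrow>
            gradient_descent (\<lambda>a. 1/2 * (norm (residual \<gamma> X y (W \<omega>) a))\<^sup>2) \<eta> 0
              \<longlonglongrightarrow> (THE \<alpha>. least_norm_minimizer (\<lambda>a. (norm (residual \<gamma> X y (W \<omega>) a))\<^sup>2) \<alpha>
                             \<and> (norm (residual \<gamma> X y (W \<omega>) \<alpha>))\<^sup>2 = 0)))"
proof -
  define F where "F \<omega> = feature_matrix \<gamma> X (W \<omega>)" for \<omega>
  define V where "V k \<omega> = feature_vector \<gamma> X (column k (W \<omega>))" for k \<omega>
  define \<kappa> where "\<kappa> = lambda_min (expected_gram \<gamma> X)"
  define R where "R = real CARD('n) * C\<^sup>2"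
  define E where "E = {\<omega> \<in> space M. \<not> (\<exists>a. F \<omega> *v a = y)}"
  interpret prob_space M
    by (rule M)
  have residual: "residual \<gamma> X y (W \<omega>) a = F \<omega> *v a - y" for \<omega> a
    by (simp add: residual_def F_def feature_matrix_def)
  have cont: "continuous_on UNIV \<gamma>"
    using lipschitz by (rule lipschitz_on_continuous_on)
  have f_meas: "feature_vector \<gamma> X \<in> borel_measurable borel"
    using cont by (rule borel_measurable_feature_vector)
  have col_meas: "(\<lambda>\<omega>. column k (W \<omega>)) \<in> borel_measurable M" for k
    using indep by (auto simp: indep_vars_def)
  have indep_V: "indep_vars (\<lambda>_. borel) V UNIV"
    unfolding V_def using indep f_meas by (rule indep_vars_compose2)
  then have V_meas: "V k \<in> borel_measurable M" for k
    by (auto simp: indep_vars_def)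
  have F_meas: "F \<in> borel_measurable M"
  proof (intro borel_measurable_vecI)
    show "(\<lambda>\<omega>. F \<omega> $ i $ k) \<in> borel_measurable M" for i k
      unfolding F_def feature_matrix_nth V_def[symmetric]
      by (intro borel_measurable_times borel_measurable_const borel_measurable_vec_nth V_meas)
  qed
  have solvable_meas: "{\<omega> \<in> space M. \<exists>a. F \<omega> *v a = y} \<in> events"
    using measurable_sets[OF F_meas borel_solvable_systems[of y]]
    by (simp add: vimage_def Int_def conj_commute)
  then have E_meas: "E \<in> events"
    unfolding E_def by (rule sets.sets_Collect_neg)
  have sphere_bound: "AE w in uniform_sphere. (norm (feature_vector \<gamma> X w))\<^sup>2 \<le> R"
    using AE_uniform_sphere
    unfolding R_def by eventually_elim (intro norm_feature_vector_squared_le unit bound)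
  have V_bound: "AE \<omega> in M. (norm (V k \<omega>))\<^sup>2 \<le> R" for k
  proof -
    have "AE w in distr M borel (\<lambda>\<omega>. column k (W \<omega>)). (norm (feature_vector \<gamma> X w))\<^sup>2 \<le> R"
      unfolding uniform by (rule sphere_bound)
    then show ?thesis
      unfolding V_def by (rule AE_distrD[OF col_meas])
  qed
  have energy: "\<kappa> * (norm x)\<^sup>2 \<le> expectation (\<lambda>\<omega>. (x \<bullet> V k \<omega>)\<^sup>2)" for x k
  proof -
    have "\<kappa> * (norm x)\<^sup>2 \<le> x \<bullet> (expected_gram \<gamma> X *v x)"
      unfolding \<kappa>_def by (rule lambda_min_le_quadratic_form[OF transpose_expected_gram])
    also have "\<dots> = (\<integral>w. (x \<bullet> feature_vector \<gamma> X w)\<^sup>2 \<partial>uniform_sphere)"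
      by (rule expected_gram_quadratic_form[OF cont sphere_bound])
    also have "\<dots> = expectation (\<lambda>\<omega>. (x \<bullet> V k \<omega>)\<^sup>2)"
      unfolding V_def uniform[of k, symmetric] using f_meas
      by (intro integral_distr col_meas) measurable
    finally show ?thesis .
  qed
  have \<kappa>: "\<kappa> > 0"
    using lambda_min_pos by (simp add: \<kappa>_def)
  then have R: "R > 0"
    using energy_le_square_bound[OF V_meas V_bound energy] by fastforce
  \<comment> \<open>On \<open>E\<close>, some \<open>u \<noteq> 0\<close> is orthogonal to all columns of \<open>F \<omega>\<close>, which are multiples of the feature
    vectors.\<close>
  have "prob E \<le> real CARD('n) * exp (- (\<kappa> * real CARD('m) / R))"
  proof (rule prob_not_spanning_le[OF indep_V V_bound R energy E_meas])
    fix \<omega> assume "\<omega> \<in> E"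
    then obtain u where "u \<noteq> 0" "\<And>k. u \<bullet> column k (F \<omega>) = 0"
      using unsolvable_imp_orthogonal_to_columns[of "F \<omega>" y] unfolding E_def by blast
    then show "\<exists>u. u \<noteq> 0 \<and> (\<forall>k. u \<bullet> V k \<omega> = 0)"
      by (auto simp: F_def column_feature_matrix V_def)
  qed
  also have "\<dots> \<le> \<delta>"
  proof -
    let ?n = "real CARD('n)"
    have n: "?n \<ge> 1"
      by (simp add: Suc_leI)
    have "\<delta> \<le> 2 * ?n"
      using n delta by linarith
    then have "0 \<le> ln (2 * ?n / \<delta>)"
      using delta by (intro ln_ge_zero) simp
    moreover have "10 * ln (2 * ?n / \<delta>) \<le> \<kappa> * real CARD('m) / R"
      using m \<kappa> R by (simp add: \<kappa>_def[symmetric] R_def field_simps)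
    ultimately have "exp (- (\<kappa> * real CARD('m) / R)) \<le> exp (- ln (2 * ?n / \<delta>))"
      by simp
    also have "\<dots> = \<delta> / (2 * ?n)"
      using n delta by (simp add: exp_minus)
    finally have "?n * exp (- (\<kappa> * real CARD('m) / R)) \<le> ?n * (\<delta> / (2 * ?n))"
      by (intro mult_left_mono) auto
    then show ?thesis
      using n delta by simp
  qed
  finally have "prob E \<le> \<delta>" .
  moreover have "prob {\<omega> \<in> space M. \<exists>a. F \<omega> *v a = y} = 1 - prob E"
  proof -
    have "space M - E = {\<omega> \<in> space M. \<exists>a. F \<omega> *v a = y}"
      unfolding E_def by blast
    then show ?thesis
      using prob_compl[OF E_meas] by simp
  qed
  ultimately have probability: "prob {\<omega> \<in> space M. \<exists>a. F \<omega> *v a = y} \<ge> 1 - \<delta>"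
    by simp
  have convergence: "gradient_descent (\<lambda>a. 1/2 * (norm (F \<omega> *v a - y))\<^sup>2) \<eta> 0
      \<longlonglongrightarrow> (THE \<alpha>. least_norm_minimizer (\<lambda>a. (norm (F \<omega> *v a - y))\<^sup>2) \<alpha>
                     \<and> (norm (F \<omega> *v \<alpha> - y))\<^sup>2 = 0)"
    if solvable: "\<exists>a. F \<omega> *v a = y"
      and \<eta>: "0 < \<eta>" "\<eta> < 2 / lambda_max (empirical_gram \<gamma> X (W \<omega>))" for \<omega> \<eta>
  proof -
    obtain a where a: "a \<in> range ((*v) (transpose (F \<omega>)))" "F \<omega> *v a = y"
      using solvable solvable_imp_row_space_solution by metis
    \<comment> \<open>Because \<open>2 / l\<close> is not positive for \<open>l \<le> 0\<close>, admissible step sizes force \<open>\<lambda>\<^sub>m\<^sub>a\<^sub>x > 0\<close>.\<close>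
    have "0 < 2 / lambda_max (empirical_gram \<gamma> X (W \<omega>))"
      using \<eta> by linarith
    then have "0 < lambda_max (empirical_gram \<gamma> X (W \<omega>))"
      by (simp add: zero_less_divide_iff)
    with \<eta> have "\<eta> * lambda_max (F \<omega> ** transpose (F \<omega>)) < 2"
      by (simp add: empirical_gram_eq F_def field_simps)
    moreover have "(THE \<alpha>. least_norm_minimizer (\<lambda>a. (norm (F \<omega> *v a - y))\<^sup>2) \<alpha>
        \<and> (norm (F \<omega> *v \<alpha> - y))\<^sup>2 = 0) = a"
      using a(2) by (intro the_equality) (auto simp: least_norm_minimizer_row_space[OF a])
    ultimately show ?thesis
      using gradient_descent_tendsto_row_space_solution[OF a \<eta>(1)] by simp
  qed
  show ?thesis
    unfolding residual unique_interpolating_least_norm_iff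
    using probability convergence by blast
qed

end
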